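(* Suppose $(A,B)$ is controllable. For each $M>0$ let $\hat x_M\in C([0,T],\mathbb R^n)$ be a path, and suppose the family $\{\hat x_M\}_{M>0}$ is uniformly bounded with respect to $M$ in the norm $\big(\int_0^T\|\cdot\|^2dt\big)^{1/2}$. Consider finitely many agents with fixed initial states $x_1^0,\dots,x_N^0$, each applying, for the given $M$, the optimal tracking control law of $\hat x_M$ (i.e. $u_i^*=-\frac1rB^T(\Gamma x_i+\beta_j)$ if $x_i^0\in D_j(\hat x_M)$, with $\Gamma,\beta_j,D_j$ computed with terminal weight $M$ and tracked path $\hat x_M$). Then for every $\epsilon>0$ there exists $M_0>0$ such that for all $M>M_0$, every agent's state at time $T$ lies in a ball of radius $\epsilon$ centered at one of the points $p_1,\dots,p_l$.
   Context: Agents have dynamics $\dot x_i=Ax_i+Bu_i$, $x_i(0)=x_i^0$, with $A\in\mathbb R^{n\times n}$, $B\in\mathbb R^{n\times m}$; constants $q,r,M>0$, horizon $T>0$, destinations $p_1,\dots,p_l\in\mathbb R^n$. For a tracked path $\hat x$ and a given $M$, $\Gamma,\beta_k,\delta_k$ are the unique solutions on $[0,T]$ of $\dot\Gamma-\frac1r\Gamma BB^T\Gamma+\Gamma A+A^T\Gamma+qI_n=0$, $\Gamma(T)=MI_n$; $\dot\beta_k=(\frac1r\Gamma BB^T-A^T)\beta_k+q\hat x$, $\beta_k(T)=-Mp_k$; $\dot\delta_k=\frac1{2r}\beta_k^TBB^T\beta_k-\frac q2\hat x^T\hat x$, $\delta_k(T)=\frac M2p_k^Tp_k$. Basins: $D_j(\hat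 x)=\{x:(\beta_j(0)-\beta_k(0))^Tx\le\delta_k(0)-\delta_j(0)\ \forall k\}$, with ties broken in favor of the smallest index $j$. This control law is the optimal control for the cost $\int_0^T\{\frac q2\|x_i-\hat x\|^2+\frac r2\|u_i\|^2\}dt+\frac M2\min_j\|x_i(T)-p_j\|^2$. *)

theory Defs
  imports "HOL-Analysis.Analysis"
begin

text \<open>Kalman controllability: the columns of B, AB, ..., A^(n-1)B span R^n,
  i.e. the controllability matrix [B, AB, ..., A^(n-1) B] has rank n.\<close>
definition controllable :: "real^'n^'n \<Rightarrow> real^'m^'n \<Rightarrow> bool" where
  "controllable A B \<longleftrightarrow>
     span (\<Union>k<CARD('n). range (\<lambda>v. (((*v) A) ^^ k) (B *v v))) = (UNIV :: (real^'n) set)"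

text \<open>Basin D_j, given beta_k(0) (b0 k) and delta_k(0) (d0 k), destinations indexed 1..l.\<close>
definition basin :: "nat \<Rightarrow> (nat \<Rightarrow> real^'n) \<Rightarrow> (nat \<Rightarrow> real) \<Rightarrow> nat \<Rightarrow> (real^'n) set" where
  "basin l b0 d0 j = {x. \<forall>k\<in>{1..l}. (b0 j - b0 k) \<bullet> x \<le> d0 k - d0 j}"

text \<open>Index of the basin containing x, ties broken in favour of the smallest index.\<close>
definition basin_index :: "nat \<Rightarrow> (nat \<Rightarrow> real^'n) \<Rightarrow> (nat \<Rightarrow> real) \<Rightarrow> real^'n \<Rightarrow> nat" where
  "basin_index l b0 d0 x = (LEAST j. j \<in> {1..l} \<and> x \<in> basin l b0 d0 j)"

end

theory Submission
  imports Defs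
begin

text \<open>
  With \<open>V\<^sub>k(t,y) = 1/2 y\<^sup>T \<Gamma>(t) y + \<beta>\<^sub>k(t)\<^sup>T y + \<delta>\<^sub>k(t)\<close>, the Riccati equations make the derivative
  of \<open>V\<^sub>k\<close> along any trajectory of \<open>x' = A x + B u\<close> equal to \<open>r/2 |u - u\<^sub>k\<^sup>*|\<^sup>2\<close> minus the running
  cost, and \<open>V\<^sub>k(T,y) = M/2 |y - p\<^sub>k|\<^sup>2\<close>. If \<open>j\<close> is the basin index of \<open>x\<^sub>i\<^sup>0\<close>, then
  \<open>M/2 |x\<^sub>i(T) - p\<^sub>j|\<^sup>2 = V\<^sub>j(T, x\<^sub>i(T)) \<le> V\<^sub>j(0, x\<^sub>i\<^sup>0) \<le> V\<^sub>k(0, x\<^sub>i\<^sup>0)\<close>, because the basin index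
  minimises \<open>V\<^sub>k(0, x\<^sub>i\<^sup>0)\<close> over \<open>k\<close>; and \<open>V\<^sub>k(0, x\<^sub>i\<^sup>0)\<close> is at most the cost of any control
  steering \<open>x\<^sub>i\<^sup>0\<close> to \<open>p\<^sub>k\<close> at time \<open>T\<close>. Controllability provides such a control independent of
  \<open>M\<close>, and the \<open>L\<^sup>2\<close> bound on the tracked paths bounds its cost uniformly in \<open>M\<close>, so
  \<open>|x\<^sub>i(T) - p\<^sub>j|\<^sup>2 = O(1/M)\<close>.
\<close>

lemma inner_matrix_vector_transpose:
  fixes A :: "real^'m^'n"
  shows "x \<bullet> (A *v y) = (transpose A *v x) \<bullet> y"
  by (simp add: dot_lmul_matrix)

lemma inner_symmetric_matrix_vector:
  fixes G :: "real^'n^'n"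
  assumes "transpose G = G"
  shows "x \<bullet> (G *v y) = (G *v x) \<bullet> y"
  by (metis assms inner_matrix_vector_transpose)

lemma inner_mult_transpose_eq_norm:
  fixes B :: "real^'m^'n"
  shows "x \<bullet> ((B ** transpose B) *v x) = (norm (transpose B *v x))\<^sup>2"
  by (simp add: matrix_vector_mul_assoc[symmetric] inner_matrix_vector_transpose power2_norm_eq_inner)

lemma uminus_matrix_vector_mult: "(- A) *v x = - (A *v (x :: real^'n))"
  by (simp add: matrix_vector_mult_def vec_eq_iff sum_negf)

lemma inner_linear_apply_coordinates:
  fixes f :: "real^'n \<Rightarrow> real^'n"
  assumes "linear f"
  shows "v \<bullet> f w = w \<bullet> (\<chi> i. v \<bullet> f (axis i 1))"
proof -
  have "f w = (\<Sum>i\<in>UNIV. w $ i *\<^sub>R f (axis i 1))"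
    using linear_sum[OF assms] linear_scale[OF assms] basis_expansion[of w]
    by (metis (no_types, lifting) scalar_mult_eq_scaleR sum.cong)
  then have "v \<bullet> f w = (\<Sum>i\<in>UNIV. w $ i * (v \<bullet> f (axis i 1)))"
    by (simp add: inner_sum_right)
  then show ?thesis by (simp add: inner_vec_def)
qed

lemma bounded_bilinear_matrix_vector_mult: "bounded_bilinear (\<lambda>(M::real^'n^'m) (v::real^'n). M *v v)"
proof -
  have "bilinear (\<lambda>(M::real^'n^'m) (v::real^'n). M *v v)"
    unfolding bilinear_def
    by (auto intro!: linearI simp: matrix_vector_right_distrib matrix_vector_mult_add_rdistrib
        scaleR_matrix_vector_assoc matrix_vector_mult_scaleR)
  then show ?thesis using bilinear_conv_bounded_bilinear by blast
qed

lemma bounded_bilinear_matrix_mult: "bounded_bilinear (\<lambda>(X::real^'n^'n) (Y::real^'n^'n). X ** Y)"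
proof -
  have "bilinear (\<lambda>(X::real^'n^'n) (Y::real^'n^'n). X ** Y)"
    unfolding bilinear_def
    by (auto intro!: linearI simp: matrix_eq matrix_vector_mul_assoc[symmetric] matrix_vector_right_distrib
        matrix_vector_mult_add_rdistrib scaleR_matrix_vector_assoc[symmetric] matrix_vector_mult_scaleR)
  then show ?thesis using bilinear_conv_bounded_bilinear by blast
qed

lemma bounded_linear_transpose: "bounded_linear (transpose :: real^'n^'m \<Rightarrow> real^'m^'n)"
proof -
  have "linear (transpose :: real^'n^'m \<Rightarrow> real^'m^'n)"
    by (auto intro!: linearI simp: transpose_def vec_eq_iff)
  then show ?thesis using linear_conv_bounded_linear by blast
qed

section \<open>Symmetry of the Riccati solution\<close>

lemma gronwall_backward_zero:
  fixes f f' :: "real \<Rightarrow> real"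
  assumes deriv: "\<And>s. s \<in> {a..b} \<Longrightarrow> (f has_real_derivative f' s) (at s within {a..b})"
    and growth: "\<And>s. s \<in> {a..b} \<Longrightarrow> - K * f s \<le> f' s"
    and nonneg: "\<And>s. s \<in> {a..b} \<Longrightarrow> 0 \<le> f s"
    and end_zero: "f b = 0" and t: "t \<in> {a..b}"
  shows "f t = 0"
proof -
  define h where "h s = f s * exp (K * s)" for s
  have "continuous_on {a..b} f"
    using deriv by (meson DERIV_continuous continuous_on_eq_continuous_within)
  then have "continuous_on {t..b} h"
    unfolding h_def using t by (auto intro!: continuous_intros elim!: continuous_on_subset)
  then have "h t \<le> h b"
  proof (rule DERIV_nonneg_imp_increasing_open[rotated 2])
    fix s assume s: "t < s" "s < b"
    then have s_in: "s \<in> {a..b}" using t by auto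
    have "at s within {a..b} = at s" using s t by (intro at_within_Icc_at) auto
    then have "(h has_real_derivative (f' s + K * f s) * exp (K * s)) (at s)"
      unfolding h_def using deriv[OF s_in] by (auto intro!: derivative_eq_intros simp: algebra_simps)
    moreover have "0 \<le> (f' s + K * f s) * exp (K * s)"
      using growth[OF s_in] by simp
    ultimately show "\<exists>y. (h has_real_derivative y) (at s) \<and> 0 \<le> y" by blast
  qed (use t in auto)
  then have "f t \<le> 0" using end_zero by (simp add: h_def mult_le_0_iff)
  with nonneg[OF t] show ?thesis by simp
qed

lemma vanishes_if_derivative_linearly_bounded:
  fixes D D' :: "real \<Rightarrow> 'a::real_inner"
  assumes deriv: "\<And>s. s \<in> {a..b} \<Longrightarrow> (D has_vector_derivative D' s) (at s within {a..b})"
    and bound: "\<And>s. s \<in> {a..b} \<Longrightarrow> norm (D' s) \<le> K * norm (D s)"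
    and "D b = 0" and "t \<in> {a..b}"
  shows "D t = 0"
proof -
  have "D t \<bullet> D t = 0"
  proof (rule gronwall_backward_zero[where f = "\<lambda>s. D s \<bullet> D s" and f' = "\<lambda>s. 2 * (D s \<bullet> D' s)"
        and K = "2 * K"])
    fix s assume s: "s \<in> {a..b}"
    show "((\<lambda>s. D s \<bullet> D s) has_real_derivative 2 * (D s \<bullet> D' s)) (at s within {a..b})"
      using bounded_bilinear.has_vector_derivative[OF bounded_bilinear_inner deriv[OF s] deriv[OF s]]
      by (simp add: has_real_derivative_iff_has_vector_derivative inner_commute)
    have "\<bar>D s \<bullet> D' s\<bar> \<le> norm (D s) * norm (D' s)" by (rule Cauchy_Schwarz_ineq2)
    also have "\<dots> \<le> norm (D s) * (K * norm (D s))" by (rule mult_left_mono[OF bound[OF s] norm_ge_zero])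
    finally show "- (2 * K) * (D s \<bullet> D s) \<le> 2 * (D s \<bullet> D' s)"
      by (simp add: dot_square_norm power2_eq_square algebra_simps abs_le_iff)
  qed (use assms in auto)
  then show ?thesis by simp
qed

lemma riccati_skew_part_has_derivative:
  fixes G :: "real \<Rightarrow> real^'n^'n" and A :: "real^'n^'n" and B :: "real^'m^'n"
  assumes G': "(G has_vector_derivative ((1/r) *\<^sub>R (G s ** B ** transpose B ** G s)
           - G s ** A - transpose A ** G s - q *\<^sub>R mat 1)) (at s within S)"
  defines "C \<equiv> B ** transpose B" and "D \<equiv> \<lambda>s. G s - transpose (G s)"
  shows "(D has_vector_derivative (1/r) *\<^sub>R (D s ** C ** G s + transpose (G s) ** C ** D s)
    - D s ** A - transpose A ** D s) (at s within S)"
proof -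
  interpret matrix_mult: bounded_bilinear "\<lambda>(X::real^'n^'n) (Y::real^'n^'n). X ** Y"
    by (rule bounded_bilinear_matrix_mult)
  interpret transpose: bounded_linear "transpose :: real^'n^'n \<Rightarrow> real^'n^'n"
    by (rule bounded_linear_transpose)
  define R where "R = (1/r) *\<^sub>R (G s ** C ** G s) - G s ** A - transpose A ** G s - q *\<^sub>R mat 1"
  have "(D has_vector_derivative R - transpose R) (at s within S)"
    unfolding D_def R_def C_def using G' bounded_linear.has_vector_derivative[OF bounded_linear_transpose G']
    by (auto intro!: derivative_eq_intros simp: matrix_mul_assoc)
  moreover have "R - transpose R = (1/r) *\<^sub>R (D s ** C ** G s + transpose (G s) ** C ** D s)
    - D s ** A - transpose A ** D s"
  proof -
    have "transpose C = C" unfolding C_def by (simp add: matrix_transpose_mul)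
    then have "transpose R = (1/r) *\<^sub>R (transpose (G s) ** C ** transpose (G s))
        - transpose (G s) ** A - transpose A ** transpose (G s) - q *\<^sub>R mat 1"
      unfolding R_def by (simp add: transpose.diff transpose_scalar matrix_transpose_mul matrix_mul_assoc)
    then show ?thesis
      unfolding R_def D_def
      by (simp add: matrix_mult.diff_left matrix_mult.diff_right matrix_mult.add_left
          matrix_mult.add_right matrix_mul_assoc algebra_simps)
  qed
  ultimately show ?thesis by simp
qed

lemma riccati_solution_symmetric:
  fixes G :: "real \<Rightarrow> real^'n^'n" and A :: "real^'n^'n" and B :: "real^'m^'n"
  assumes G': "\<And>s. s \<in> {a..b} \<Longrightarrow> (G has_vector_derivative ((1/r) *\<^sub>R (G s ** B ** transpose B ** G s)
           - G s ** A - transpose A ** G s - q *\<^sub>R mat 1)) (at s within {a..b})"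
    and end_sym: "transpose (G b) = G b" and t: "t \<in> {a..b}"
  shows "transpose (G t) = G t"
proof -
  define C where "C = B ** transpose B"
  define D where "D s = G s - transpose (G s)" for s
  obtain K where K: "\<And>(X::real^'n^'n) (Y::real^'n^'n). norm (X ** Y) \<le> norm X * norm Y * K" and "K \<ge> 0"
    using bounded_bilinear.nonneg_bounded[OF bounded_bilinear_matrix_mult] by blast
  then have norm_triple_product: "norm (X ** Y ** Z) \<le> norm X * norm Y * norm Z * K\<^sup>2" for X Y Z :: "real^'n^'n"
    using K[of "X ** Y" Z] mult_right_mono[OF K[of X Y], of "norm Z * K"]
    by (simp add: power2_eq_square mult.assoc mult.left_commute)
  have "continuous_on {a..b} G"
    using G' by (meson has_vector_derivative_continuous continuous_on_eq_continuous_within)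
  then have "continuous_on {a..b} (\<lambda>s. norm (G s) + norm (transpose (G s)))"
    by (intro continuous_intros bounded_linear.continuous_on[OF bounded_linear_transpose])
  then obtain Gm where Gm: "\<And>s. s \<in> {a..b} \<Longrightarrow> norm (norm (G s) + norm (transpose (G s))) \<le> Gm"
    by (rule continuous_on_compact_bound[OF compact_Icc]) blast
  have G_bound: "norm (G s) \<le> Gm" "norm (transpose (G s)) \<le> Gm" if "s \<in> {a..b}" for s
    using Gm[OF that] by (smt (verit) norm_ge_zero real_norm_def)+
  define L where "L = \<bar>1/r\<bar> * 2 * norm C * Gm * K\<^sup>2 + norm A * K + norm (transpose A) * K"
  have "D t = 0"
  proof (rule vanishes_if_derivative_linearly_bounded[where K = L])
    fix s assume s: "s \<in> {a..b}"
    show "(D has_vector_derivative (1/r) *\<^sub>R (D s ** C ** G s + transpose (G s) ** C ** D s)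
        - D s ** A - transpose A ** D s) (at s within {a..b})"
      unfolding D_def C_def by (rule riccati_skew_part_has_derivative[OF G'[OF s]])
    have "norm ((1/r) *\<^sub>R (D s ** C ** G s + transpose (G s) ** C ** D s) - D s ** A - transpose A ** D s)
        \<le> \<bar>1/r\<bar> * (norm (D s ** C ** G s) + norm (transpose (G s) ** C ** D s))
          + norm (D s ** A) + norm (transpose A ** D s)"
      by (smt (verit) norm_triangle_ineq norm_triangle_ineq4 norm_scaleR mult_left_mono abs_ge_zero)
    also have "\<dots> \<le> \<bar>1/r\<bar> * (norm (D s) * norm C * Gm * K\<^sup>2 + Gm * norm C * norm (D s) * K\<^sup>2)
        + norm (D s) * norm A * K + norm (transpose A) * norm (D s) * K"
    proof (intro add_mono mult_left_mono K)
      show "norm (D s ** C ** G s) \<le> norm (D s) * norm C * Gm * K\<^sup>2"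
        using norm_triple_product[of "D s" C "G s"] G_bound(1)[OF s] by (meson mult_left_mono mult_right_mono
            mult_nonneg_nonneg norm_ge_zero zero_le_power2 order_trans)
      show "norm (transpose (G s) ** C ** D s) \<le> Gm * norm C * norm (D s) * K\<^sup>2"
        using norm_triple_product[of "transpose (G s)" C "D s"] G_bound(2)[OF s] by (meson mult_left_mono mult_right_mono
            mult_nonneg_nonneg norm_ge_zero zero_le_power2 order_trans)
    qed simp
    also have "\<dots> = L * norm (D s)"
      unfolding L_def by (simp add: algebra_simps)
    finally show "norm ((1/r) *\<^sub>R (D s ** C ** G s + transpose (G s) ** C ** D s) - D s ** A
        - transpose A ** D s) \<le> L * norm (D s)" .
  qed (use end_sym t in \<open>auto simp: D_def\<close>)
  then show ?thesis by (simp add: D_def)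
qed

section \<open>The value function and completion of the square\<close>

lemma riccati_quadratic_form:
  fixes A G :: "real^'n^'n" and B :: "real^'m^'n"
  assumes sym: "transpose G = G"
  shows "y \<bullet> (((1/r) *\<^sub>R (G ** B ** transpose B ** G) - G ** A - transpose A ** G - q *\<^sub>R mat 1) *v y)
    = (1/r) * (norm (transpose B *v (G *v y)))\<^sup>2 - 2 * ((G *v y) \<bullet> (A *v y)) - q * (norm y)\<^sup>2"
proof -
  have "y \<bullet> ((G ** B ** transpose B ** G) *v y) = (norm (transpose B *v (G *v y)))\<^sup>2"
    using inner_mult_transpose_eq_norm[of "G *v y" B] inner_symmetric_matrix_vector[OF sym]
    by (simp add: matrix_vector_mul_assoc[symmetric] matrix_mul_assoc)
  moreover have "y \<bullet> ((G ** A) *v y) = (G *v y) \<bullet> (A *v y)"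
    by (simp add: matrix_vector_mul_assoc[symmetric] inner_symmetric_matrix_vector[OF sym])
  moreover have "y \<bullet> ((transpose A ** G) *v y) = (G *v y) \<bullet> (A *v y)"
  proof -
    have "y \<bullet> ((transpose A ** G) *v y) = y \<bullet> (transpose A *v (G *v y))"
      by (simp only: matrix_vector_mul_assoc)
    also have "\<dots> = (A *v y) \<bullet> (G *v y)"
      by (subst inner_matrix_vector_transpose) (simp only: transpose_transpose)
    finally show ?thesis by (simp only: inner_commute)
  qed
  ultimately show ?thesis
    by (simp add: matrix_vector_mult_diff_rdistrib scaleR_matrix_vector_assoc[symmetric]
        inner_diff_right power2_norm_eq_inner)
qed

lemma costate_linear_form:
  fixes A G :: "real^'n^'n" and B :: "real^'m^'n"
  assumes sym: "transpose G = G"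
  shows "(((1/r) *\<^sub>R (G ** B ** transpose B) - transpose A) *v b + q *\<^sub>R xh) \<bullet> y
    = (1/r) * ((transpose B *v b) \<bullet> (transpose B *v (G *v y))) - b \<bullet> (A *v y) + q * (xh \<bullet> y)"
proof -
  have "((G ** B ** transpose B) *v b) \<bullet> y = (B *v (transpose B *v b)) \<bullet> (G *v y)"
  proof -
    have "(G ** B ** transpose B) *v b = G *v (B *v (transpose B *v b))"
      by (simp only: matrix_vector_mul_assoc matrix_mul_assoc)
    then show ?thesis
      by (simp only: inner_commute[of _ y] inner_symmetric_matrix_vector[OF sym])
  qed
  also have "\<dots> = (transpose B *v b) \<bullet> (transpose B *v (G *v y))"
    by (subst inner_commute, subst inner_matrix_vector_transpose, rule inner_commute)
  moreover have "(transpose A *v b) \<bullet> y = b \<bullet> (A *v y)"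
    by (simp add: inner_matrix_vector_transpose)
  ultimately show ?thesis
    by (simp add: matrix_vector_mult_diff_rdistrib scaleR_matrix_vector_assoc[symmetric]
        inner_diff_left inner_add_left)
qed

lemma riccati_completion_of_square:
  fixes A G :: "real^'n^'n" and B :: "real^'m^'n" and y b xh :: "real^'n" and u :: "real^'m"
  assumes sym: "transpose G = G" and r: "r \<noteq> 0"
  shows "(G *v y) \<bullet> (A *v y + B *v u)
      + (1/2) * (y \<bullet> (((1/r) *\<^sub>R (G ** B ** transpose B ** G) - G ** A - transpose A ** G - q *\<^sub>R mat 1) *v y))
      + ((((1/r) *\<^sub>R (G ** B ** transpose B) - transpose A) *v b + q *\<^sub>R xh) \<bullet> y)
      + b \<bullet> (A *v y + B *v u)
      + ((1 / (2*r)) * (b \<bullet> ((B ** transpose B) *v b)) - (q/2) * (xh \<bullet> xh))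
    = (r/2) * (norm (u + (1/r) *\<^sub>R (transpose B *v (G *v y + b))))\<^sup>2
      - (q/2) * (norm (y - xh))\<^sup>2 - (r/2) * (norm u)\<^sup>2"
proof -
  define P where "P = transpose B *v (G *v y)"
  define Q where "Q = transpose B *v b"
  have "(G *v y) \<bullet> (A *v y + B *v u)
      + (1/2) * (y \<bullet> (((1/r) *\<^sub>R (G ** B ** transpose B ** G) - G ** A - transpose A ** G - q *\<^sub>R mat 1) *v y))
      + ((((1/r) *\<^sub>R (G ** B ** transpose B) - transpose A) *v b + q *\<^sub>R xh) \<bullet> y)
      + b \<bullet> (A *v y + B *v u)
      + ((1 / (2*r)) * (b \<bullet> ((B ** transpose B) *v b)) - (q/2) * (xh \<bullet> xh))
    = P \<bullet> u + Q \<bullet> u + (1 / (2*r)) * ((norm P)\<^sup>2 + 2 * (Q \<bullet> P) + (norm Q)\<^sup>2)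
      - (q/2) * ((norm y)\<^sup>2 - 2 * (xh \<bullet> y) + (norm xh)\<^sup>2)"
    unfolding P_def Q_def riccati_quadratic_form[OF sym] costate_linear_form[OF sym] inner_mult_transpose_eq_norm
    using r by (simp add: inner_add_right inner_matrix_vector_transpose[of _ B] power2_norm_eq_inner field_simps)
  also have "\<dots> = (r/2) * (norm (u + (1/r) *\<^sub>R (transpose B *v (G *v y + b))))\<^sup>2
      - (q/2) * (norm (y - xh))\<^sup>2 - (r/2) * (norm u)\<^sup>2"
  proof -
    have "transpose B *v (G *v y + b) = P + Q"
      unfolding P_def Q_def by (rule matrix_vector_right_distrib)
    moreover have "(norm (u + (1/r) *\<^sub>R (P + Q)))\<^sup>2 = (norm u)\<^sup>2 + (2/r) * (P \<bullet> u + Q \<bullet> u)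
        + ((norm P)\<^sup>2 + 2 * (Q \<bullet> P) + (norm Q)\<^sup>2) / r\<^sup>2"
      unfolding power2_norm_eq_inner using r
      by (simp add: inner_add_left inner_add_right inner_commute field_simps power2_eq_square)
    moreover have "(norm (y - xh))\<^sup>2 = (norm y)\<^sup>2 - 2 * (xh \<bullet> y) + (norm xh)\<^sup>2"
      by (simp add: power2_norm_eq_inner inner_diff_left inner_diff_right inner_commute)
    ultimately show ?thesis
      using r by (simp only:) (simp add: field_simps power2_eq_square)
  qed
  finally show ?thesis .
qed

definition quadratic_value :: "real^'n^'n \<Rightarrow> real^'n \<Rightarrow> real \<Rightarrow> real^'n \<Rightarrow> real" where
  "quadratic_value G b d y = (1/2) * (y \<bullet> (G *v y)) + b \<bullet> y + d"

lemma quadratic_value_has_derivative: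
  fixes A :: "real^'n^'n" and B :: "real^'m^'n" and G :: "real \<Rightarrow> real^'n^'n"
    and b y :: "real \<Rightarrow> real^'n" and d :: "real \<Rightarrow> real" and u :: "real^'m"
  assumes sym: "transpose (G t) = G t" and r: "r \<noteq> 0"
    and G': "(G has_vector_derivative ((1/r) *\<^sub>R (G t ** B ** transpose B ** G t)
               - G t ** A - transpose A ** G t - q *\<^sub>R mat 1)) (at t within S)"
    and b': "(b has_vector_derivative
               (((1/r) *\<^sub>R (G t ** B ** transpose B) - transpose A) *v b t + q *\<^sub>R xh)) (at t within S)"
    and d': "(d has_real_derivative
               (1 / (2*r)) * (b t \<bullet> ((B ** transpose B) *v b t)) - (q/2) * (xh \<bullet> xh)) (at t within S)"
    and y': "(y has_vector_derivative (A *v y t + B *v u)) (at t within S)"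
  shows "((\<lambda>s. quadratic_value (G s) (b s) (d s) (y s)) has_real_derivative
     (r/2) * (norm (u + (1/r) *\<^sub>R (transpose B *v (G t *v y t + b t))))\<^sup>2
     - (q/2) * (norm (y t - xh))\<^sup>2 - (r/2) * (norm u)\<^sup>2) (at t within S)"
proof -
  define G'' where "G'' = (1/r) *\<^sub>R (G t ** B ** transpose B ** G t) - G t ** A - transpose A ** G t - q *\<^sub>R mat 1"
  define b'' where "b'' = ((1/r) *\<^sub>R (G t ** B ** transpose B) - transpose A) *v b t + q *\<^sub>R xh"
  define d'' where "d'' = (1 / (2*r)) * (b t \<bullet> ((B ** transpose B) *v b t)) - (q/2) * (xh \<bullet> xh)"
  define y'' where "y'' = A *v y t + B *v u"
  have "((\<lambda>s. G s *v y s) has_vector_derivative (G t *v y'' + G'' *v y t)) (at t within S)"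
    using bounded_bilinear.has_vector_derivative[OF bounded_bilinear_matrix_vector_mult
        G'[folded G''_def] y'[folded y''_def]] .
  from bounded_bilinear.has_vector_derivative[OF bounded_bilinear_inner y'[folded y''_def] this]
    bounded_bilinear.has_vector_derivative[OF bounded_bilinear_inner b'[folded b''_def] y'[folded y''_def]]
    d'[folded d''_def]
  have deriv: "((\<lambda>s. quadratic_value (G s) (b s) (d s) (y s)) has_real_derivative
      (1/2) * (y t \<bullet> (G t *v y'' + G'' *v y t) + y'' \<bullet> (G t *v y t)) + (b t \<bullet> y'' + b'' \<bullet> y t) + d'')
      (at t within S)"
    unfolding quadratic_value_def has_real_derivative_iff_has_vector_derivative
    by (auto intro!: derivative_eq_intros)
  have "(1/2) * (y t \<bullet> (G t *v y'' + G'' *v y t) + y'' \<bullet> (G t *v y t)) + (b t \<bullet> y'' + b'' \<bullet> y t) + d''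
      = (G t *v y t) \<bullet> y'' + (1/2) * (y t \<bullet> (G'' *v y t)) + b'' \<bullet> y t + b t \<bullet> y'' + d''"
    using inner_symmetric_matrix_vector[OF sym, of "y t" y'']
    by (simp add: inner_add_right inner_commute[of y''] algebra_simps)
  also have "\<dots> = (r/2) * (norm (u + (1/r) *\<^sub>R (transpose B *v (G t *v y t + b t))))\<^sup>2
      - (q/2) * (norm (y t - xh))\<^sup>2 - (r/2) * (norm u)\<^sup>2"
    unfolding G''_def b''_def d''_def y''_def by (rule riccati_completion_of_square[OF sym r])
  finally show ?thesis using deriv by (simp only:)
qed

lemma quadratic_value_terminal:
  "quadratic_value (M *\<^sub>R mat 1) (- (M *\<^sub>R p)) ((M/2) * (p \<bullet> p)) z = (M/2) * (norm (z - p))\<^sup>2"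
  by (simp add: quadratic_value_def power2_norm_eq_inner inner_diff_left inner_diff_right inner_commute
      scaleR_matrix_vector_assoc[symmetric] algebra_simps)

locale lq_tracking =
  fixes A :: "real^'n^'n" and B :: "real^'m^'n" and q r T :: real and xh :: "real \<Rightarrow> real^'n"
    and G :: "real \<Rightarrow> real^'n^'n" and b :: "real \<Rightarrow> real^'n" and d :: "real \<Rightarrow> real"
  assumes q_nonneg: "0 \<le> q" and r_pos: "0 < r" and T_nonneg: "0 \<le> T"
    and xh_cont: "continuous_on {0..T} xh"
    and G_ode: "\<And>t. t \<in> {0..T} \<Longrightarrow> (G has_vector_derivative ((1/r) *\<^sub>R (G t ** B ** transpose B ** G t)
          - G t ** A - transpose A ** G t - q *\<^sub>R mat 1)) (at t within {0..T})"
    and G_end_sym: "transpose (G T) = G T"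
    and b_ode: "\<And>t. t \<in> {0..T} \<Longrightarrow> (b has_vector_derivative
          (((1/r) *\<^sub>R (G t ** B ** transpose B) - transpose A) *v b t + q *\<^sub>R xh t)) (at t within {0..T})"
    and d_ode: "\<And>t. t \<in> {0..T} \<Longrightarrow> (d has_real_derivative
          (1 / (2*r)) * (b t \<bullet> ((B ** transpose B) *v b t)) - (q/2) * (xh t \<bullet> xh t)) (at t within {0..T})"
begin

definition cost_to_go :: "real \<Rightarrow> real^'n \<Rightarrow> real" where
  "cost_to_go t y = quadratic_value (G t) (b t) (d t) y"

definition feedback :: "real \<Rightarrow> real^'n \<Rightarrow> real^'m" where
  "feedback t y = - ((1/r) *\<^sub>R (transpose B *v (G t *v y + b t)))"

definition running_cost :: "real^'n \<Rightarrow> real \<Rightarrow> real^'m \<Rightarrow> real" where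
  "running_cost y t u = (q/2) * (norm (y - xh t))\<^sup>2 + (r/2) * (norm u)\<^sup>2"

lemma running_cost_nonneg: "0 \<le> running_cost y t u"
  using q_nonneg r_pos by (simp add: running_cost_def)

lemma G_symmetric: "t \<in> {0..T} \<Longrightarrow> transpose (G t) = G t"
  using riccati_solution_symmetric[OF G_ode G_end_sym] .

lemma cost_to_go_change_has_integral:
  assumes y': "\<And>t. t \<in> {0..T} \<Longrightarrow> (y has_vector_derivative (A *v y t + B *v u t)) (at t within {0..T})"
  shows "((\<lambda>t. (r/2) * (norm (u t - feedback t (y t)))\<^sup>2 - running_cost (y t) t (u t))
    has_integral cost_to_go T (y T) - cost_to_go 0 (y 0)) {0..T}"
proof -
  have "((\<lambda>t. cost_to_go t (y t)) has_vector_derivative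
      (r/2) * (norm (u t - feedback t (y t)))\<^sup>2 - running_cost (y t) t (u t)) (at t within {0..T})"
    if t: "t \<in> {0..T}" for t
    using quadratic_value_has_derivative[OF G_symmetric[OF t] _ G_ode[OF t] b_ode[OF t] d_ode[OF t] y'[OF t]]
      r_pos
    by (simp add: has_real_derivative_iff_has_vector_derivative[symmetric] cost_to_go_def feedback_def
        running_cost_def algebra_simps)
  then show ?thesis
    by (rule fundamental_theorem_of_calculus[OF T_nonneg, where f = "\<lambda>t. cost_to_go t (y t)"])
qed

lemma cost_to_go_nonincreasing_under_feedback:
  assumes y': "\<And>t. t \<in> {0..T} \<Longrightarrow>
      (y has_vector_derivative (A *v y t + B *v feedback t (y t))) (at t within {0..T})"
  shows "cost_to_go T (y T) \<le> cost_to_go 0 (y 0)"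
proof -
  have "cost_to_go T (y T) - cost_to_go 0 (y 0) \<le> 0"
  proof (rule has_integral_le[OF cost_to_go_change_has_integral[OF y'] has_integral_0])
    show "(r/2) * (norm (feedback t (y t) - feedback t (y t)))\<^sup>2 - running_cost (y t) t (feedback t (y t)) \<le> 0"
      for t
      using running_cost_nonneg by simp
  qed
  then show ?thesis by simp
qed

lemma cost_to_go_le_tracking_cost:
  assumes y': "\<And>t. t \<in> {0..T} \<Longrightarrow> (y has_vector_derivative (A *v y t + B *v u t)) (at t within {0..T})"
    and u_cont: "continuous_on {0..T} u"
  shows "cost_to_go 0 (y 0) \<le> cost_to_go T (y T) + integral {0..T} (\<lambda>t. running_cost (y t) t (u t))"
proof -
  have "continuous_on {0..T} y"
    using y' by (meson has_vector_derivative_continuous continuous_on_eq_continuous_within)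
  then have "(\<lambda>t. running_cost (y t) t (u t)) integrable_on {0..T}"
    unfolding running_cost_def by (intro integrable_continuous_interval continuous_intros xh_cont u_cont)
  then have "((\<lambda>t. - running_cost (y t) t (u t)) has_integral
      - integral {0..T} (\<lambda>t. running_cost (y t) t (u t))) {0..T}"
    by (rule has_integral_neg[OF integrable_integral])
  then have "- integral {0..T} (\<lambda>t. running_cost (y t) t (u t)) \<le> cost_to_go T (y T) - cost_to_go 0 (y 0)"
    by (rule has_integral_le[OF _ cost_to_go_change_has_integral[OF y']]) (use r_pos in \<open>auto\<close>)
  then show ?thesis by simp
qed

end

section \<open>Comparison with an admissible control\<close>

lemma basin_index_minimizes:
  assumes "1 \<le> l"
  shows "basin_index l b0 d0 x \<in> {1..l}"
    and "\<And>k. k \<in> {1..l} \<Longrightarrow> b0 (basin_index l b0 d0 x) \<bullet> x + d0 (basin_index l b0 d0 x) \<le> b0 k \<bullet> x + d0 k"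
proof -
  obtain k0 where k0: "k0 \<in> {1..l}" "\<And>k. k \<in> {1..l} \<Longrightarrow> b0 k0 \<bullet> x + d0 k0 \<le> b0 k \<bullet> x + d0 k"
    using ex_is_arg_min_if_finite[of "{1..l}" "\<lambda>k. b0 k \<bullet> x + d0 k"] assms
    by (fastforce simp: is_arg_min_linorder)
  then have "k0 \<in> {1..l} \<and> x \<in> basin l b0 d0 k0"
    by (auto simp: basin_def inner_diff_left algebra_simps)
  then have "basin_index l b0 d0 x \<in> {1..l} \<and> x \<in> basin l b0 d0 (basin_index l b0 d0 x)"
    unfolding basin_index_def by (rule LeastI)
  then show "basin_index l b0 d0 x \<in> {1..l}"
    and "\<And>k. k \<in> {1..l} \<Longrightarrow> b0 (basin_index l b0 d0 x) \<bullet> x + d0 (basin_index l b0 d0 x) \<le> b0 k \<bullet> x + d0 k"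
    by (auto simp: basin_def inner_diff_left algebra_simps)
qed

lemma basin_feedback_terminal_cost_le_tracking_cost:
  fixes A :: "real^'n^'n" and B :: "real^'m^'n" and G :: "real \<Rightarrow> real^'n^'n"
    and b :: "nat \<Rightarrow> real \<Rightarrow> real^'n" and d :: "nat \<Rightarrow> real \<Rightarrow> real"
  assumes lq: "\<And>k. k \<in> {1..l} \<Longrightarrow> lq_tracking A B q r T xh G (b k) (d k)"
    and G_end: "G T = M *\<^sub>R mat 1"
    and b_end: "\<And>k. k \<in> {1..l} \<Longrightarrow> b k T = - (M *\<^sub>R p k)"
    and d_end: "\<And>k. k \<in> {1..l} \<Longrightarrow> d k T = (M/2) * (p k \<bullet> p k)"
    and l: "1 \<le> l"
    and y0: "y 0 = x0"
    and y': "\<And>t. t \<in> {0..T} \<Longrightarrow> (y has_vector_derivative (A *v y t + B *v (- ((1/r) *\<^sub>R (transpose B *v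
          (G t *v y t + b (basin_index l (\<lambda>k. b k 0) (\<lambda>k. d k 0) x0) t)))))) (at t within {0..T})"
    and Y': "\<And>t. t \<in> {0..T} \<Longrightarrow> (Y has_vector_derivative (A *v Y t + B *v U t)) (at t within {0..T})"
    and U_cont: "continuous_on {0..T} U"
    and Y0: "Y 0 = x0" and YT: "Y T = p k" and k: "k \<in> {1..l}"
  shows "\<exists>j\<in>{1..l}. (M/2) * (norm (y T - p j))\<^sup>2
    \<le> integral {0..T} (\<lambda>t. (q/2) * (norm (Y t - xh t))\<^sup>2 + (r/2) * (norm (U t))\<^sup>2)"
proof
  define j where "j = basin_index l (\<lambda>k. b k 0) (\<lambda>k. d k 0) x0"
  show j: "j \<in> {1..l}"
    unfolding j_def by (rule basin_index_minimizes(1)[OF l])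
  interpret J: lq_tracking A B q r T xh G "b j" "d j" by (rule lq[OF j])
  interpret K: lq_tracking A B q r T xh G "b k" "d k" by (rule lq[OF k])
  have "(M/2) * (norm (y T - p j))\<^sup>2 = J.cost_to_go T (y T)"
    unfolding J.cost_to_go_def G_end b_end[OF j] d_end[OF j] quadratic_value_terminal ..
  also have "\<dots> \<le> J.cost_to_go 0 (y 0)"
    by (rule J.cost_to_go_nonincreasing_under_feedback) (use y'[folded j_def] in \<open>simp add: J.feedback_def\<close>)
  also have "\<dots> \<le> K.cost_to_go 0 (Y 0)"
    using basin_index_minimizes(2)[OF l k, of "\<lambda>k. b k 0" "\<lambda>k. d k 0" x0, folded j_def]
    by (simp add: J.cost_to_go_def K.cost_to_go_def quadratic_value_def y0 Y0)
  also have "\<dots> \<le> K.cost_to_go T (Y T) + integral {0..T} (\<lambda>t. K.running_cost (Y t) t (U t))"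
    by (rule K.cost_to_go_le_tracking_cost[OF Y' U_cont])
  also have "\<dots> = integral {0..T} (\<lambda>t. (q/2) * (norm (Y t - xh t))\<^sup>2 + (r/2) * (norm (U t))\<^sup>2)"
    unfolding K.cost_to_go_def K.running_cost_def G_end b_end[OF k] d_end[OF k] YT
      quadratic_value_terminal by simp
  finally show "(M/2) * (norm (y T - p j))\<^sup>2
    \<le> integral {0..T} (\<lambda>t. (q/2) * (norm (Y t - xh t))\<^sup>2 + (r/2) * (norm (U t))\<^sup>2)" .
qed

lemma tracking_cost_le:
  fixes Y xh :: "real \<Rightarrow> 'a::real_normed_vector" and U :: "real \<Rightarrow> 'b::real_normed_vector"
  assumes q: "0 \<le> q" and Y_cont: "continuous_on {0..T} Y" and U_cont: "continuous_on {0..T} U"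
    and xh_cont: "continuous_on {0..T} xh"
    and xh_bound: "sqrt (integral {0..T} (\<lambda>t. (norm (xh t))\<^sup>2)) \<le> C"
  shows "integral {0..T} (\<lambda>t. (q/2) * (norm (Y t - xh t))\<^sup>2 + (r/2) * (norm (U t))\<^sup>2)
    \<le> integral {0..T} (\<lambda>t. q * (norm (Y t))\<^sup>2 + (r/2) * (norm (U t))\<^sup>2) + q * C\<^sup>2"
proof -
  have pointwise: "(q/2) * (norm (Y t - xh t))\<^sup>2 \<le> q * (norm (Y t))\<^sup>2 + q * (norm (xh t))\<^sup>2" for t
  proof -
    have "(norm (Y t - xh t))\<^sup>2 \<le> (norm (Y t) + norm (xh t))\<^sup>2"
      by (rule power_mono[OF norm_triangle_ineq4 norm_ge_zero])
    also have "\<dots> \<le> 2 * (norm (Y t))\<^sup>2 + 2 * (norm (xh t))\<^sup>2"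
      using zero_le_power2[of "norm (Y t) - norm (xh t)"] by (simp add: power2_eq_square algebra_simps)
    finally have "(q/2) * (norm (Y t - xh t))\<^sup>2 \<le> (q/2) * (2 * (norm (Y t))\<^sup>2 + 2 * (norm (xh t))\<^sup>2)"
      by (rule mult_left_mono) (use q in simp)
    then show ?thesis by (simp add: algebra_simps)
  qed
  have "0 \<le> integral {0..T} (\<lambda>t. (norm (xh t))\<^sup>2)"
    by (intro integral_nonneg integrable_continuous_interval continuous_intros xh_cont) simp
  then have energy: "integral {0..T} (\<lambda>t. (norm (xh t))\<^sup>2) \<le> C\<^sup>2"
    using power_mono[OF xh_bound real_sqrt_ge_zero, of 2] by simp
  have "integral {0..T} (\<lambda>t. (q/2) * (norm (Y t - xh t))\<^sup>2 + (r/2) * (norm (U t))\<^sup>2)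
      \<le> integral {0..T} (\<lambda>t. (q * (norm (Y t))\<^sup>2 + (r/2) * (norm (U t))\<^sup>2) + q * (norm (xh t))\<^sup>2)"
    using pointwise
    by (intro integral_le integrable_continuous_interval continuous_intros Y_cont U_cont xh_cont)
      (simp add: algebra_simps)
  also have "\<dots> = integral {0..T} (\<lambda>t. q * (norm (Y t))\<^sup>2 + (r/2) * (norm (U t))\<^sup>2)
      + q * integral {0..T} (\<lambda>t. (norm (xh t))\<^sup>2)"
    by (simp add: integral_add integrable_continuous_interval continuous_intros Y_cont U_cont xh_cont)
  also have "\<dots> \<le> integral {0..T} (\<lambda>t. q * (norm (Y t))\<^sup>2 + (r/2) * (norm (U t))\<^sup>2) + q * C\<^sup>2"
    using mult_left_mono[OF energy q] by simp
  finally show ?thesis .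
qed

section \<open>The flow of a linear system\<close>

text \<open>HOL-Analysis provides no Banach algebra of square matrices or of bounded linear maps, so the
  flow \<open>e\<^sup>t\<^sup>A\<close> of \<open>x' = A x\<close> is obtained from the library's \<open>exp\<close> on a copy of the bounded linear
  maps of \<open>real^'a\<close> with composition as product.\<close>

typedef (overloaded) ('a::finite) endo = "UNIV :: ((real^'a) \<Rightarrow>\<^sub>L (real^'a)) set"
  morphisms Op Endo by simp

setup_lifting type_definition_endo

instantiation endo :: (finite) real_normed_algebra_1
begin
lift_definition zero_endo :: "'a endo" is 0 .
lift_definition one_endo :: "'a endo" is id_blinfun .
lift_definition plus_endo :: "'a endo \<Rightarrow> 'a endo \<Rightarrow> 'a endo" is "(+)" .
lift_definition minus_endo :: "'a endo \<Rightarrow> 'a endo \<Rightarrow> 'a endo" is "(-)" .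
lift_definition uminus_endo :: "'a endo \<Rightarrow> 'a endo" is uminus .
lift_definition times_endo :: "'a endo \<Rightarrow> 'a endo \<Rightarrow> 'a endo" is "(o\<^sub>L)" .
lift_definition scaleR_endo :: "real \<Rightarrow> 'a endo \<Rightarrow> 'a endo" is "(*\<^sub>R)" .
lift_definition norm_endo :: "'a endo \<Rightarrow> real" is norm .
definition dist_endo :: "'a endo \<Rightarrow> 'a endo \<Rightarrow> real" where "dist_endo a b = norm (a - b)"
definition sgn_endo :: "'a endo \<Rightarrow> 'a endo" where "sgn_endo x = scaleR (inverse (norm x)) x"
definition
  "(uniformity :: ('a endo \<times> 'a endo) filter) = (INF e\<in>{0 <..}. principal {(x, y). dist x y < e})"
definition open_endo :: "'a endo set \<Rightarrow> bool"
  where "open_endo S = (\<forall>x\<in>S. \<forall>\<^sub>F (x', y) in uniformity. x' = x \<longrightarrow> y \<in> S)"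
instance
proof
  fix a b c :: "'a endo" and r s :: real
  show "a + b + c = a + (b + c)" by transfer (simp add: add.assoc)
  show "a + b = b + a" by transfer (simp add: add.commute)
  show "0 + a = a" by transfer simp
  show "- a + a = 0" by transfer simp
  show "a - b = a + - b" by transfer simp
  show "r *\<^sub>R (a + b) = r *\<^sub>R a + r *\<^sub>R b" by transfer (simp add: scaleR_add_right)
  show "(r + s) *\<^sub>R a = r *\<^sub>R a + s *\<^sub>R a" by transfer (simp add: scaleR_add_left)
  show "r *\<^sub>R s *\<^sub>R a = (r * s) *\<^sub>R a" by transfer simp
  show "1 *\<^sub>R a = a" by transfer simp
  show "a * b * c = a * (b * c)" by transfer (auto intro!: blinfun_eqI)
  show "(a + b) * c = a * c + b * c" by transfer (auto intro!: blinfun_eqI simp: blinfun.add_left)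
  show "a * (b + c) = a * b + a * c" by transfer (auto intro!: blinfun_eqI simp: blinfun.add_right plus_blinfun.rep_eq)
  show "1 * a = a" by transfer (auto intro!: blinfun_eqI)
  show "a * 1 = a" by transfer (auto intro!: blinfun_eqI)
  show "(0::'a endo) \<noteq> 1"
  proof transfer
    show "(0::(real^'a) \<Rightarrow>\<^sub>L (real^'a)) \<noteq> id_blinfun"
      by (metis norm_blinfun_id norm_zero zero_neq_one)
  qed
  show "r *\<^sub>R a * b = r *\<^sub>R (a * b)" by transfer (auto intro!: blinfun_eqI simp: blinfun.scaleR_left)
  show "a * r *\<^sub>R b = r *\<^sub>R (a * b)" by transfer (auto intro!: blinfun_eqI simp: blinfun.scaleR_right scaleR_blinfun.rep_eq)
  show "norm (a * b) \<le> norm a * norm b" by transfer (rule norm_blinfun_compose)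
  show "norm (1::'a endo) = 1" by transfer simp
  show "dist a b = norm (a - b)" by (simp add: dist_endo_def)
  show "sgn a = inverse (norm a) *\<^sub>R a" by (simp add: sgn_endo_def)
  show "(uniformity :: ('a endo \<times> 'a endo) filter) = (INF e\<in>{0 <..}. principal {(x, y). dist x y < e})"
    by (simp add: uniformity_endo_def)
  fix U :: "'a endo set"
  show "open U = (\<forall>x\<in>U. \<forall>\<^sub>F (x', y) in uniformity. x' = x \<longrightarrow> y \<in> U)"
    by (simp add: open_endo_def)
  show "(norm a = 0) = (a = 0)" by transfer simp
  show "norm (a + b) \<le> norm a + norm b" by transfer (rule norm_triangle_ineq)
  show "norm (r *\<^sub>R a) = \<bar>r\<bar> * norm a" by transfer simp
qed
end

lemma dist_Op: "dist (Op a) (Op b) = dist a b"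
  by (simp add: dist_norm dist_endo_def norm_endo.rep_eq minus_endo.rep_eq)

instance endo :: (finite) banach
proof
  fix X :: "nat \<Rightarrow> 'a endo"
  assume "Cauchy X"
  then have "Cauchy (\<lambda>n. Op (X n))" unfolding Cauchy_def by (simp add: dist_Op)
  then obtain L where L: "(\<lambda>n. Op (X n)) \<longlonglongrightarrow> L" using convergent_def Cauchy_convergent_iff by blast
  have "X \<longlonglongrightarrow> Endo L"
    unfolding lim_sequentially
  proof (intro allI impI)
    fix e :: real assume "e > 0"
    then obtain N where "\<forall>n\<ge>N. dist (Op (X n)) L < e" using L unfolding lim_sequentially by blast
    then show "\<exists>N. \<forall>n\<ge>N. dist (X n) (Endo L) < e"
      by (metis dist_Op Endo_inverse UNIV_I)
  qed
  then show "convergent X" unfolding convergent_def by blast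
qed

lemma Op_times: "Op (a * b) v = Op a (Op b v)" by transfer simp
lemma Op_one: "Op 1 v = v" by transfer simp
lemma Op_uminus: "Op (- a) = - Op a" by transfer simp
lemma norm_Op: "norm (Op a) = norm a" by transfer simp

lemma bounded_linear_Op: "bounded_linear (Op :: 'n::finite endo \<Rightarrow> _)"
  by (rule bounded_linear_intro[where K = 1]) (simp_all add: plus_endo.rep_eq scaleR_endo.rep_eq norm_Op)

lemma bounded_bilinear_Op_apply: "bounded_bilinear (\<lambda>(X::'n::finite endo) v. Op X v)"
  using bounded_bilinear.comp1[OF bounded_bilinear_blinfun_apply bounded_linear_Op] by simp

definition endo_of_matrix :: "real^'n^'n \<Rightarrow> 'n endo" where
  "endo_of_matrix A = Endo (Blinfun ((*v) A))"

lemma Op_endo_of_matrix: "Op (endo_of_matrix A) v = A *v v"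
  by (simp add: endo_of_matrix_def Endo_inverse bounded_linear_Blinfun_apply)

lemma endo_of_matrix_uminus: "endo_of_matrix (- A) = - endo_of_matrix A"
  by (rule Op_inject[THEN iffD1])
    (auto intro!: blinfun_eqI simp: Op_uminus Op_endo_of_matrix uminus_matrix_vector_mult uminus_blinfun.rep_eq)

definition linear_flow :: "real^'n^'n \<Rightarrow> real \<Rightarrow> real^'n \<Rightarrow> real^'n" where
  "linear_flow A t = Op (exp (t *\<^sub>R endo_of_matrix A))"

lemma linear_flow_zero [simp]: "linear_flow A 0 v = v"
  by (simp add: linear_flow_def Op_one)

lemma linear_flow_inverse: "linear_flow A t (linear_flow (- A) t v) = v"
  by (simp add: linear_flow_def endo_of_matrix_uminus Op_times[symmetric] exp_minus_inverse Op_one)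

lemma bounded_linear_linear_flow: "bounded_linear (linear_flow A t)"
  unfolding linear_flow_def by (rule blinfun.bounded_linear_right)

lemma linear_flow_has_vector_derivative:
  assumes "(f has_vector_derivative f') (at t within S)"
  shows "((\<lambda>s. linear_flow A s (f s)) has_vector_derivative
    A *v linear_flow A t (f t) + linear_flow A t f') (at t within S)"
  using bounded_bilinear.has_vector_derivative[OF bounded_bilinear_Op_apply
      has_vector_derivative_at_within[OF exp_scaleR_has_vector_derivative_left[of "endo_of_matrix A"]] assms]
  by (simp add: linear_flow_def Op_times Op_endo_of_matrix add.commute)

lemma linear_flow_has_vector_derivative_right:
  "((\<lambda>s. linear_flow A s v) has_vector_derivative linear_flow A t (A *v v)) (at t)"
  using bounded_linear.has_vector_derivative[OF
      bounded_bilinear.bounded_linear_left[OF bounded_bilinear_Op_apply]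
      exp_scaleR_has_vector_derivative_right[of "endo_of_matrix A"]]
  by (simp add: linear_flow_def Op_times Op_endo_of_matrix)

lemma continuous_on_linear_flow:
  assumes "continuous_on S g"
  shows "continuous_on S (\<lambda>s. linear_flow A s (g s))"
proof -
  have "continuous_on S (\<lambda>s. Op (exp (s *\<^sub>R endo_of_matrix A)))"
    by (intro bounded_linear.continuous_on[OF bounded_linear_Op] continuous_at_imp_continuous_on ballI
        has_vector_derivative_continuous[OF exp_scaleR_has_vector_derivative_left])
  then show ?thesis
    unfolding linear_flow_def by (rule bounded_bilinear.continuous_on[OF bounded_bilinear_blinfun_apply _ assms])
qed

section \<open>Reachability of controllable systems\<close>

lemma controllable_orthogonal_flow_imp_zero:
  fixes A :: "real^'n^'n" and B :: "real^'m^'n"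
  assumes ctrl: "controllable A B" and T: "0 < T"
    and orth: "\<And>s w. s \<in> {0<..<T} \<Longrightarrow> v \<bullet> linear_flow (- A) s (B *v w) = 0"
  shows "v = 0"
proof -
  \<comment> \<open>Up to sign, \<open>h w k\<close> is the \<open>k\<close>-th derivative of \<open>s \<mapsto> v \<bullet> e\<^sup>-\<^sup>s\<^sup>A B w\<close>; at \<open>s = 0\<close> its
    vanishing says \<open>v \<bottom> A\<^sup>k B w\<close>.\<close>
  define h where "h w k s = v \<bullet> linear_flow (- A) s ((((*v) A) ^^ k) (B *v w))" for w k s
  have h_deriv: "(h w k has_real_derivative - h w (Suc k) s) (at s)" for w k s
  proof -
    have "linear_flow (- A) s ((- A) *v x) = - linear_flow (- A) s (A *v x)" for x
      by (simp add: uminus_matrix_vector_mult linear_neg[OF bounded_linear.linear[OF bounded_linear_linear_flow]])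
    then show ?thesis
      using bounded_linear.has_vector_derivative[OF bounded_linear_inner_right[of v]
          linear_flow_has_vector_derivative_right[where A = "- A" and v = "(((*v) A) ^^ k) (B *v w)" and t = s]]
      by (simp add: h_def[abs_def] has_real_derivative_iff_has_vector_derivative)
  qed
  have vanish: "h w k s = 0" if "s \<in> {0<..<T}" for w k s
    using that
  proof (induction k arbitrary: s)
    case 0
    then show ?case using orth by (simp add: h_def)
  next
    case (Suc k)
    have "(h w k has_real_derivative 0) (at s)"
      by (rule has_field_derivative_transform_within_open[of "\<lambda>_. 0" _ _ "{0<..<T}"])
        (use Suc in auto)
    with h_deriv[of w k s] show ?case by (auto dest: DERIV_unique)
  qed
  have closed: "closed {s. h w k s = 0}" for w k
  proof -
    have "continuous_on UNIV (h w k)"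
      using h_deriv by (meson DERIV_continuous continuous_at_imp_continuous_on)
    then show ?thesis by (rule closed_Collect_eq[OF _ continuous_on_const])
  qed
  have closure_vanish: "closure {0<..<T} \<subseteq> {s. h w k s = 0}" for w k
    using vanish by (intro closure_minimal[OF _ closed]) auto
  have "h w k 0 = 0" for w k
    using subsetD[OF closure_vanish[of w k], of 0] T by simp
  then have "orthogonal v x" if "x \<in> (\<Union>k<CARD('n). range (\<lambda>w. (((*v) A) ^^ k) (B *v w)))" for x
    using that by (auto simp: h_def orthogonal_def)
  moreover have "v \<in> span (\<Union>k<CARD('n). range (\<lambda>w. (((*v) A) ^^ k) (B *v w)))"
    using ctrl unfolding controllable_def by simp
  ultimately have "orthogonal v v"
    by (rule orthogonal_to_span[rotated])
  then show ?thesis by (simp add: orthogonal_def)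
qed

text \<open>The vector \<open>\<chi> i. v \<bullet> linear_flow (- A) s (axis i 1)\<close> is \<open>e\<^sup>-\<^sup>s\<^sup>A\<^sup>T v\<close>, so \<open>steering_control\<close> is the
  classical control \<open>B\<^sup>T e\<^sup>-\<^sup>s\<^sup>A\<^sup>T v\<close> and \<open>gramian_apply\<close> applies the controllability Gramian
  \<open>\<integral>\<^sub>0\<^sup>T e\<^sup>-\<^sup>s\<^sup>A B B\<^sup>T e\<^sup>-\<^sup>s\<^sup>A\<^sup>T ds\<close> to \<open>v\<close>.\<close>

definition steering_control :: "real^'n^'n \<Rightarrow> real^'m^'n \<Rightarrow> real^'n \<Rightarrow> real \<Rightarrow> real^'m" where
  "steering_control A B v s = transpose B *v (\<chi> i. v \<bullet> linear_flow (- A) s (axis i 1))"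

definition gramian_apply :: "real^'n^'n \<Rightarrow> real^'m^'n \<Rightarrow> real \<Rightarrow> real^'n \<Rightarrow> real^'n" where
  "gramian_apply A B T v = integral {0..T} (\<lambda>s. linear_flow (- A) s (B *v steering_control A B v s))"

lemma continuous_on_steering_control: "continuous_on S (steering_control A B v)"
  unfolding steering_control_def
  by (intro bounded_linear.continuous_on[OF matrix_vector_mul_bounded_linear]
      continuous_on_vec_lambda continuous_intros continuous_on_linear_flow)

lemma continuous_on_linear_flow_steering:
  "continuous_on S (\<lambda>s. linear_flow (- A) s (B *v steering_control A B v s))"
  by (intro continuous_on_linear_flow bounded_linear.continuous_on[OF matrix_vector_mul_bounded_linear]
      continuous_on_steering_control)

lemma linear_gramian_apply: "linear (gramian_apply A B T)"
proof -
  have "steering_control A B (c *\<^sub>R v + c' *\<^sub>R v') s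
      = c *\<^sub>R steering_control A B v s + c' *\<^sub>R steering_control A B v' s" for c c' v v' s
  proof -
    have "(\<chi> i. (c *\<^sub>R v + c' *\<^sub>R v') \<bullet> linear_flow (- A) s (axis i 1))
        = c *\<^sub>R (\<chi> i. v \<bullet> linear_flow (- A) s (axis i 1)) + c' *\<^sub>R (\<chi> i. v' \<bullet> linear_flow (- A) s (axis i 1))"
      by (simp add: vec_eq_iff inner_add_left)
    then show ?thesis
      unfolding steering_control_def
      by (simp only: matrix_vector_right_distrib matrix_vector_mult_scaleR)
  qed
  then have "linear_flow (- A) s (B *v steering_control A B (c *\<^sub>R v + c' *\<^sub>R v') s)
      = c *\<^sub>R linear_flow (- A) s (B *v steering_control A B v s)
        + c' *\<^sub>R linear_flow (- A) s (B *v steering_control A B v' s)" for c c' v v' s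
    by (simp add: matrix_vector_right_distrib matrix_vector_mult_scaleR
        linear_add[OF bounded_linear.linear[OF bounded_linear_linear_flow]]
        linear_scale[OF bounded_linear.linear[OF bounded_linear_linear_flow]])
  then have comb: "gramian_apply A B T (c *\<^sub>R v + c' *\<^sub>R v')
      = c *\<^sub>R gramian_apply A B T v + c' *\<^sub>R gramian_apply A B T v'" for c c' v v'
    unfolding gramian_apply_def
    by (simp add: integral_add integrable_continuous_interval continuous_intros
        continuous_on_linear_flow_steering)
  show ?thesis
    by (intro linearI) (use comb[of 1 _ 1] in simp, use comb[of _ _ 0] in simp)
qed

lemma inner_gramian_apply:
  "v \<bullet> gramian_apply A B T v = integral {0..T} (\<lambda>s. (norm (steering_control A B v s))\<^sup>2)"
proof -
  have "v \<bullet> linear_flow (- A) s (B *v steering_control A B v s) = (norm (steering_control A B v s))\<^sup>2"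
    for s
  proof -
    define c where "c = (\<chi> i. v \<bullet> linear_flow (- A) s (axis i 1))"
    have "v \<bullet> linear_flow (- A) s (B *v steering_control A B v s) = (B *v steering_control A B v s) \<bullet> c"
      unfolding c_def by (rule inner_linear_apply_coordinates[OF bounded_linear.linear[OF bounded_linear_linear_flow]])
    also have "\<dots> = steering_control A B v s \<bullet> (transpose B *v c)"
      by (simp only: inner_commute inner_matrix_vector_transpose)
    also have "\<dots> = (norm (steering_control A B v s))\<^sup>2"
      by (simp only: steering_control_def c_def power2_norm_eq_inner)
    finally show ?thesis .
  qed
  moreover have "v \<bullet> gramian_apply A B T v = integral {0..T} (\<lambda>s. v \<bullet> linear_flow (- A) s (B *v steering_control A B v s))"
    unfolding gramian_apply_def
    by (intro integral_linear[OF _ bounded_linear_inner_right, symmetric, unfolded o_def]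
        integrable_continuous_interval continuous_on_linear_flow_steering)
  ultimately show ?thesis by simp
qed

lemma gramian_apply_surj:
  fixes A :: "real^'n^'n" and B :: "real^'m^'n"
  assumes ctrl: "controllable A B" and T: "0 < T"
  shows "surj (gramian_apply A B T)"
proof (rule ccontr)
  let ?W = "gramian_apply A B T"
  assume "\<not> surj ?W"
  moreover have "span (range ?W) = range ?W"
    using linear_subspace_image[OF linear_gramian_apply subspace_UNIV] by (simp add: span_eq_iff)
  ultimately have "dim (range ?W) < DIM(real^'n)"
    using dim_subset_UNIV[of "range ?W"] dim_eq_full[of "range ?W"] by (metis le_neq_implies_less)
  then obtain v :: "real^'n" where "v \<noteq> 0" and v_orth: "\<And>y. y \<in> span (range ?W) \<Longrightarrow> orthogonal v y"
    using orthogonal_to_subspace_exists by blast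
  have "integral {0..T} (\<lambda>s. (norm (steering_control A B v s))\<^sup>2) = 0"
    using v_orth[of "?W v"] by (simp add: span_base orthogonal_def inner_gramian_apply)
  then have "(norm (steering_control A B v s))\<^sup>2 = 0" if "s \<in> {0..T}" for s
    using integral_eq_0_iff[of 0 T "\<lambda>s. (norm (steering_control A B v s))\<^sup>2"] T that
    by (simp add: continuous_intros continuous_on_steering_control)
  then have "v \<bullet> linear_flow (- A) s (B *v w) = 0" if "s \<in> {0<..<T}" for s w
    using that inner_linear_apply_coordinates[OF bounded_linear.linear[OF bounded_linear_linear_flow],
        of v "- A" s "B *v w"]
    by (simp add: inner_commute[of "B *v w"] inner_matrix_vector_transpose steering_control_def)
  then have "v = 0"
    by (rule controllable_orthogonal_flow_imp_zero[OF ctrl T])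
  with \<open>v \<noteq> 0\<close> show False by simp
qed

lemma controllable_reachable:
  fixes A :: "real^'n^'n" and B :: "real^'m^'n"
  assumes ctrl: "controllable A B" and T: "0 < T"
  obtains y u where "continuous_on {0..T} u" and "y 0 = start" and "y T = target"
    and "\<And>t. t \<in> {0..T} \<Longrightarrow> (y has_vector_derivative (A *v y t + B *v u t)) (at t within {0..T})"
proof -
  obtain v where v: "gramian_apply A B T v = linear_flow (- A) T target - start"
    using gramian_apply_surj[OF ctrl T] by (metis surjD)
  define u where "u = steering_control A B v"
  define g where "g s = linear_flow (- A) s (B *v u s)" for s
  define y where "y t = linear_flow A t (start + integral {0..t} g)" for t
  show ?thesis
  proof (rule that[of u y])
    show "continuous_on {0..T} u"
      unfolding u_def by (rule continuous_on_steering_control)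
    show "y 0 = start"
      by (simp add: y_def)
    show "y T = target"
      using v by (simp add: y_def g_def[abs_def] u_def gramian_apply_def linear_flow_inverse)
    fix t assume t: "t \<in> {0..T}"
    have "((\<lambda>s. start + integral {0..s} g) has_vector_derivative g t) (at t within {0..T})"
      unfolding g_def u_def
      using integral_has_vector_derivative[OF continuous_on_linear_flow_steering t]
      by (auto intro!: derivative_eq_intros)
    from linear_flow_has_vector_derivative[OF this, of A]
    show "(y has_vector_derivative A *v y t + B *v u t) (at t within {0..T})"
      by (simp add: y_def[abs_def] g_def linear_flow_inverse)
  qed
qed

section \<open>Convergence to the destinations\<close>

lemma ex_threshold_scaled_square_le:
  fixes K \<epsilon> :: real
  assumes "0 < \<epsilon>"
  shows "\<exists>M0>0. \<forall>M>M0. \<forall>a. (M/2) * a\<^sup>2 \<le> K \<longrightarrow> \<bar>a\<bar> < \<epsilon>"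
proof (intro exI[of _ "2 * \<bar>K\<bar> / \<epsilon>\<^sup>2 + 1"] conjI allI impI)
  show "0 < 2 * \<bar>K\<bar> / \<epsilon>\<^sup>2 + 1"
    by (simp add: add_nonneg_pos)
  fix M a :: real
  assume M: "2 * \<bar>K\<bar> / \<epsilon>\<^sup>2 + 1 < M" and bound: "(M/2) * a\<^sup>2 \<le> K"
  have "0 < \<epsilon>\<^sup>2" and "0 \<le> 2 * \<bar>K\<bar> / \<epsilon>\<^sup>2"
    using assms by simp_all
  with M have "0 < M" and "2 * \<bar>K\<bar> < M * \<epsilon>\<^sup>2"
    by (simp_all add: field_simps, linarith+)
  moreover have "M * a\<^sup>2 \<le> 2 * \<bar>K\<bar>"
    using bound abs_ge_self[of K] by (simp add: field_simps)
  ultimately have "M * a\<^sup>2 < M * \<epsilon>\<^sup>2"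
    by linarith
  then have "\<bar>a\<bar>\<^sup>2 < \<epsilon>\<^sup>2"
    using \<open>0 < M\<close> by simp
  then show "\<bar>a\<bar> < \<epsilon>"
    using assms by (simp add: power2_less_imp_less)
qed

lemma scaled_square_bounds_imp_eventually_in_balls:
  fixes z :: "real \<Rightarrow> 'i \<Rightarrow> 'a::real_normed_vector" and c :: "'j \<Rightarrow> 'a"
  assumes "finite I"
    and bound: "\<And>i. i \<in> I \<Longrightarrow> \<exists>K. \<forall>M>0. \<exists>j\<in>J. (M/2) * (norm (z M i - c j))\<^sup>2 \<le> K"
  shows "\<forall>\<epsilon>>0. \<exists>M0>0. \<forall>M>M0. \<forall>i\<in>I. \<exists>j\<in>J. z M i \<in> ball (c j) \<epsilon>"
proof (intro allI impI)
  fix \<epsilon> :: real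
  assume "0 < \<epsilon>"
  have "\<forall>i\<in>I. \<exists>K. \<forall>M>0. \<exists>j\<in>J. (M/2) * (norm (z M i - c j))\<^sup>2 \<le> K"
    using bound by blast
  then obtain K where K: "\<forall>i\<in>I. \<forall>M>0. \<exists>j\<in>J. (M/2) * (norm (z M i - c j))\<^sup>2 \<le> K i"
    by (rule bchoice[THEN exE])
  obtain M0 where "0 < M0" and M0: "\<And>M a. M0 < M \<Longrightarrow> (M/2) * a\<^sup>2 \<le> (\<Sum>i\<in>I. \<bar>K i\<bar>) \<Longrightarrow> \<bar>a\<bar> < \<epsilon>"
    using ex_threshold_scaled_square_le[OF \<open>0 < \<epsilon>\<close>] by blast
  show "\<exists>M0>0. \<forall>M>M0. \<forall>i\<in>I. \<exists>j\<in>J. z M i \<in> ball (c j) \<epsilon>"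
  proof (intro exI[of _ M0] conjI allI impI ballI \<open>0 < M0\<close>)
    fix M i assume "M0 < M" and i: "i \<in> I"
    then have "0 < M"
      using \<open>0 < M0\<close> by linarith
    then obtain j where "j \<in> J" and "(M/2) * (norm (z M i - c j))\<^sup>2 \<le> K i"
      using K i by blast
    moreover have "K i \<le> (\<Sum>i\<in>I. \<bar>K i\<bar>)"
      using member_le_sum[OF i, of "\<lambda>i. \<bar>K i\<bar>"] \<open>finite I\<close> by simp
    ultimately show "\<exists>j\<in>J. z M i \<in> ball (c j) \<epsilon>"
      using M0[OF \<open>M0 < M\<close>, of "norm (z M i - c j)"] by (auto simp: dist_norm norm_minus_commute)
  qed
qed

theorem lemma2:
  fixes A :: "real^'n^'n" and B :: "real^'m^'n"
    and q r T :: real and l N :: nat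
    and p :: "nat \<Rightarrow> real^'n"
    and x0 :: "nat \<Rightarrow> real^'n"
    and xhat :: "real \<Rightarrow> real \<Rightarrow> real^'n"
    and \<Gamma> :: "real \<Rightarrow> real \<Rightarrow> real^'n^'n"
    and \<beta> :: "real \<Rightarrow> nat \<Rightarrow> real \<Rightarrow> real^'n"
    and \<delta> :: "real \<Rightarrow> nat \<Rightarrow> real \<Rightarrow> real"
    and x :: "real \<Rightarrow> nat \<Rightarrow> real \<Rightarrow> real^'n"
  assumes ctrl: "controllable A B"
    and q: "q > 0" and r: "r > 0" and T: "T > 0" and l: "l \<ge> 1"
    and xhat_cont: "\<And>M. M > 0 \<Longrightarrow> continuous_on {0..T} (xhat M)"
    and xhat_bdd: "\<exists>C. \<forall>M>0. sqrt (integral {0..T} (\<lambda>t. (norm (xhat M t))\<^sup>2)) \<le> C"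
    and Gamma_ode: "\<And>M t. M > 0 \<Longrightarrow> t \<in> {0..T} \<Longrightarrow>
       ((\<Gamma> M) has_vector_derivative
          ((1/r) *\<^sub>R (\<Gamma> M t ** B ** transpose B ** \<Gamma> M t)
           - \<Gamma> M t ** A - transpose A ** \<Gamma> M t - q *\<^sub>R mat 1)) (at t within {0..T})"
    and Gamma_T: "\<And>M. M > 0 \<Longrightarrow> \<Gamma> M T = M *\<^sub>R mat 1"
    and beta_ode: "\<And>M k t. M > 0 \<Longrightarrow> k \<in> {1..l} \<Longrightarrow> t \<in> {0..T} \<Longrightarrow>
       ((\<beta> M k) has_vector_derivative
          (((1/r) *\<^sub>R (\<Gamma> M t ** B ** transpose B) - transpose A) *v \<beta> M k t
           + q *\<^sub>R xhat M t)) (at t within {0..T})"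
    and beta_T: "\<And>M k. M > 0 \<Longrightarrow> k \<in> {1..l} \<Longrightarrow> \<beta> M k T = - (M *\<^sub>R p k)"
    and delta_ode: "\<And>M k t. M > 0 \<Longrightarrow> k \<in> {1..l} \<Longrightarrow> t \<in> {0..T} \<Longrightarrow>
       ((\<delta> M k) has_real_derivative
          ((1 / (2*r)) * (\<beta> M k t \<bullet> ((B ** transpose B) *v \<beta> M k t))
           - (q/2) * (xhat M t \<bullet> xhat M t))) (at t within {0..T})"
    and delta_T: "\<And>M k. M > 0 \<Longrightarrow> k \<in> {1..l} \<Longrightarrow> \<delta> M k T = (M/2) * (p k \<bullet> p k)"
    and x_init: "\<And>M i. M > 0 \<Longrightarrow> i \<in> {1..N} \<Longrightarrow> x M i 0 = x0 i"
    and x_ode: "\<And>M i t. M > 0 \<Longrightarrow> i \<in> {1..N} \<Longrightarrow> t \<in> {0..T} \<Longrightarrow>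
       ((x M i) has_vector_derivative
          (A *v x M i t + B *v (- ((1/r) *\<^sub>R (transpose B *v
             (\<Gamma> M t *v x M i t
              + \<beta> M (basin_index l (\<lambda>k. \<beta> M k 0) (\<lambda>k. \<delta> M k 0) (x0 i)) t))))))
         (at t within {0..T})"
  shows "\<forall>\<epsilon>>0. \<exists>M0>0. \<forall>M>M0. \<forall>i\<in>{1..N}. \<exists>j\<in>{1..l}. x M i T \<in> ball (p j) \<epsilon>"
proof -
  obtain C where C: "\<And>M. 0 < M \<Longrightarrow> sqrt (integral {0..T} (\<lambda>t. (norm (xhat M t))\<^sup>2)) \<le> C"
    using xhat_bdd by blast
  have lq: "lq_tracking A B q r T (xhat M) (\<Gamma> M) (\<beta> M k) (\<delta> M k)" if "0 < M" "k \<in> {1..l}" for M k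
    using that q r T xhat_cont Gamma_ode Gamma_T beta_ode delta_ode
    by unfold_locales (auto simp: transpose_scalar)
  have "\<exists>K. \<forall>M>0. \<exists>j\<in>{1..l}. (M/2) * (norm (x M i T - p j))\<^sup>2 \<le> K" if i: "i \<in> {1..N}" for i
  proof -
    obtain Y U where U: "continuous_on {0..T} U" and "Y 0 = x0 i" "Y T = p 1"
      and Y': "\<And>t. t \<in> {0..T} \<Longrightarrow> (Y has_vector_derivative (A *v Y t + B *v U t)) (at t within {0..T})"
      by (rule controllable_reachable[OF ctrl T, where start = "x0 i" and target = "p 1"]) blast
    have "continuous_on {0..T} Y"
      using Y' by (meson has_vector_derivative_continuous continuous_on_eq_continuous_within)
    have "\<exists>j\<in>{1..l}. (M/2) * (norm (x M i T - p j))\<^sup>2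
        \<le> integral {0..T} (\<lambda>t. q * (norm (Y t))\<^sup>2 + (r/2) * (norm (U t))\<^sup>2) + q * C\<^sup>2" if M: "0 < M" for M
    proof -
      obtain j where "j \<in> {1..l}" and "(M/2) * (norm (x M i T - p j))\<^sup>2
          \<le> integral {0..T} (\<lambda>t. (q/2) * (norm (Y t - xhat M t))\<^sup>2 + (r/2) * (norm (U t))\<^sup>2)"
        using basin_feedback_terminal_cost_le_tracking_cost[OF lq[OF M] Gamma_T[OF M] beta_T[OF M]
            delta_T[OF M] l x_init[OF M i] x_ode[OF M i] Y' U \<open>Y 0 = x0 i\<close> \<open>Y T = p 1\<close>] l
        by auto
      moreover note tracking_cost_le[OF less_imp_le[OF q] \<open>continuous_on {0..T} Y\<close> U xhat_cont[OF M] C[OF M]]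
      ultimately show ?thesis
        by (meson order_trans)
    qed
    then show ?thesis by blast
  qed
  then show ?thesis
    by (rule scaled_square_bounds_imp_eventually_in_balls[OF finite_atLeastAtMost])
qed

end
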